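(* Let $(\bar A,\bar B,\bar C)$ be the Kalman canonical form of a quantum linear system with $n=n_1+n_2+n_3$ oscillators and $m$ input fields, with $$\bar A=\begin{bmatrix} A_h^{11} & A_h^{12} & A_{12} & A_{13} \\ 0 & A_h^{22} & 0 & 0 \\ 0 & A_{21} & A_{co} & 0 \\ 0 & A_{31} & 0 & A_{\bar c\bar o} \end{bmatrix},\quad \bar B=\begin{bmatrix} B_h \\ 0 \\ B_{co} \\ 0 \end{bmatrix},\quad \bar C=\begin{bmatrix} 0 & C_h & C_{co} & 0 \end{bmatrix}.$$ Then $$\begin{aligned} A_h^{22\top}&=-A_h^{11},\\ -A_h^{12}+A_h^{12\top}+B_h\mathbb J_mB_h^\top&=0,\\ -A_{12}+A_{21}^\top\mathbb J_{n_1}+B_h\mathbb J_mB_{co}^\top\mathbb J_{n_1}&=0,\\ A_{31}^\top\mathbb J_{n_2}&=A_{13},\\ \mathbb J_{n_1}A_{co}+A_{co}^\top\mathbb J_{n_1}-\mathbb J_{n_1}B_{co}\mathbb J_mB_{co}^\top\mathbb J_{n_1}&=0,\\ \mathbb J_{n_2}A_{\bar c\bar o}+A_{\bar c\bar o}^\top\mathbb J_{n_2}&=0, \end{aligned}$$ and $$B_h=C_h^\top\mathbb J_m,\qquad B_{co}=\mathbb J_{n_1}C_{co}^\top\mathbb J_m.$$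
   Context: Notation: $X^{\#}$ is the entrywise complex conjugate, $X^\dag=(X^{\#})^\top$; $J_k=\mathrm{diag}(I_k,-I_k)$; $\mathbb J_k=\begin{bmatrix} 0 & I_k \\ -I_k & 0 \end{bmatrix}$; $X^\flat=J_rX^\dag J_k$ for $X\in\mathbb C^{2k\times2r}$; $\Delta(U,V)=\begin{bmatrix} U & V \\ U^{\#} & V^{\#} \end{bmatrix}$; $V_k=\frac1{\sqrt2}\begin{bmatrix} I_k & I_k \\ -\imath I_k & \imath I_k \end{bmatrix}$. Quantum linear system: $\mathcal C=\Delta(C_-,C_+)$, $\mathcal B=-\mathcal C^\flat$, $\mathcal A=-\imath J_n\Omega-\frac12\mathcal C^\flat\mathcal C$, with $C_\pm\in\mathbb C^{m\times n}$ and $\Omega=\Delta(\Omega_-,\Omega_+)\in\mathbb C^{2n\times2n}$ Hermitian. Kalman canonical form: there are $Z_j\in\mathbb C^{n\times n_j}$ ($j=1,2,3$) such that $$T=\begin{bmatrix} Z_3 & 0 & Z_1 & 0 & Z_2 & 0 \\ 0 & Z_3^{\#} & 0 & Z_1^{\#} & 0 & Z_2^{\#} \end{bmatrix}$$ is unitary with $T^\dag J_nT=\mathrm{diag}(J_{n_3},J_{n_1},J_{n_2})$; and, with $n_3=n_a+n_b$ and $$\Pi=\begin{bmatrix} I_{n_a} & 0 & 0 & 0 \\ 0 & 0 & 0 & -I_{n_b} \\ 0 & 0 & I_{n_a} & 0 \\ 0 & I_{n_b} & 0 & 0 \end{bmatrix},\qquad \tilde V_n=\mathrm{diag}(\Pi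 V_{n_3},V_{n_1},V_{n_2}),\qquad \hat T=T\tilde V_n^\dag,$$ one sets $\bar A=\hat T^\dag\mathcal A\hat T$, $\bar B=\hat T^\dag\mathcal BV_m^\dag$, $\bar C=V_m\mathcal C\hat T$ (real matrices). The coordinates $\boldsymbol x=\hat T^\dag\breve{\boldsymbol a}$ are partitioned as $\boldsymbol q_h,\boldsymbol p_h,\boldsymbol x_{co},\boldsymbol x_{\bar c\bar o}$ of lengths $n_3,n_3,2n_1,2n_2$; $(\bar A,\bar B,\bar C)$ has the displayed block form, the controllable subspace of $(\bar A,\bar B)$ is the span of the $\boldsymbol q_h,\boldsymbol x_{co}$ coordinates, and the unobservable subspace of $(\bar A,\bar C)$ is the span of the $\boldsymbol q_h,\boldsymbol x_{\bar c\bar o}$ coordinates. *)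

theory Defs
  imports
    "Jordan_Normal_Form.Matrix_Kernel"
    "Jordan_Normal_Form.Schur_Decomposition"
    "Jordan_Normal_Form.VS_Connect"
begin

definition append_cols :: "'a :: zero mat \<Rightarrow> 'a mat \<Rightarrow> 'a mat" (infixr \<open>@\<^sub>c\<close> 66) where
  "A @\<^sub>c B = four_block_mat A B (0\<^sub>m 0 (dim_col A)) (0\<^sub>m 0 (dim_col B))"

text \<open>The library's adjoint is the transpose of the entrywise conjugate, also for
  rectangular matrices.\<close>

lemma mat_adjoint_eq_transpose_cnj:
  fixes X :: "complex mat"
  shows "mat_adjoint X = (map_mat cnj X)\<^sup>T"
  by (rule eq_matI) (auto simp: mat_adjoint_def mat_of_rows_index)

definition unitary_mat :: "nat \<Rightarrow> complex mat \<Rightarrow> bool" where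
  "unitary_mat N U \<longleftrightarrow>
     U \<in> carrier_mat N N \<and> mat_adjoint U * U = 1\<^sub>m N \<and> U * mat_adjoint U = 1\<^sub>m N"

definition J_mat :: "nat \<Rightarrow> complex mat" where
  "J_mat k = diag_block_mat [1\<^sub>m k, - 1\<^sub>m k]"

definition symp_mat :: "nat \<Rightarrow> real mat" (\<open>\<J>\<close>) where
  "\<J> k = four_block_mat (0\<^sub>m k k) (1\<^sub>m k) (- 1\<^sub>m k) (0\<^sub>m k k)"

text \<open>In \<open>flat_adjoint k r X\<close> the matrix \<open>X\<close> is \<open>2 * k\<close> by \<open>2 * r\<close>, and the
  result is \<open>2 * r\<close> by \<open>2 * k\<close>.\<close>

definition flat_adjoint :: "nat \<Rightarrow> nat \<Rightarrow> complex mat \<Rightarrow> complex mat" where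
  "flat_adjoint k r X = J_mat r * mat_adjoint X * J_mat k"

definition doubled_up :: "complex mat \<Rightarrow> complex mat \<Rightarrow> complex mat" (\<open>\<Delta>\<close>) where
  "\<Delta> U V = four_block_mat U V (map_mat cnj U) (map_mat cnj V)"

definition V_mat :: "nat \<Rightarrow> complex mat" where
  "V_mat k = complex_of_real (1 / sqrt 2) \<cdot>\<^sub>m
     four_block_mat (1\<^sub>m k) (1\<^sub>m k) ((- \<i>) \<cdot>\<^sub>m 1\<^sub>m k) (\<i> \<cdot>\<^sub>m 1\<^sub>m k)"

definition quantum_linear_system ::
  "nat \<Rightarrow> nat \<Rightarrow> complex mat \<Rightarrow> complex mat \<Rightarrow> complex mat \<Rightarrow> bool" where
  "quantum_linear_system n m A B C \<longleftrightarrow>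
     (\<exists>Cminus Cplus Wminus Wplus W.
        Cminus \<in> carrier_mat m n \<and> Cplus \<in> carrier_mat m n \<and>
        Wminus \<in> carrier_mat n n \<and> Wplus \<in> carrier_mat n n \<and>
        W = \<Delta> Wminus Wplus \<and> mat_adjoint W = W \<and>
        C = \<Delta> Cminus Cplus \<and>
        B = - flat_adjoint m n C \<and>
        A = (- \<i>) \<cdot>\<^sub>m (J_mat n * W) - (1 / 2) \<cdot>\<^sub>m (flat_adjoint m n C * C))"

definition controllability_mat :: "'a :: field mat \<Rightarrow> 'a mat \<Rightarrow> 'a mat" where
  "controllability_mat A B =
     mat_of_cols (dim_row A) (concat (map (\<lambda>k. cols (A ^\<^sub>m k * B)) [0..<dim_row A]))"

definition observability_mat :: "'a :: field mat \<Rightarrow> 'a mat \<Rightarrow> 'a mat" where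
  "observability_mat A C =
     mat_of_rows (dim_row A) (concat (map (\<lambda>k. rows (C * A ^\<^sub>m k)) [0..<dim_row A]))"

definition controllable_subspace :: "'a :: field mat \<Rightarrow> 'a mat \<Rightarrow> 'a vec set" where
  "controllable_subspace A B = vec_space.col_space (dim_row A) (controllability_mat A B)"

definition unobservable_subspace :: "'a :: field mat \<Rightarrow> 'a mat \<Rightarrow> 'a vec set" where
  "unobservable_subspace A C = mat_kernel (observability_mat A C)"

definition coordinate_span :: "nat \<Rightarrow> nat set \<Rightarrow> real vec set" where
  "coordinate_span N I = LinearCombinations.module.span class_ring (module_vec TYPE(real) N) (unit_vec N ` I)"

text \<open>The blocks of \<open>\<Pi>\<close>, in row and column order \<open>(na, nb, na, nb)\<close>, are grouped
  two by two.\<close>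

definition Pi_mat :: "nat \<Rightarrow> nat \<Rightarrow> complex mat" where
  "Pi_mat na nb = four_block_mat
     (diag_block_mat [1\<^sub>m na, 0\<^sub>m nb nb]) (diag_block_mat [0\<^sub>m na na, - 1\<^sub>m nb])
     (diag_block_mat [0\<^sub>m na na, 1\<^sub>m nb]) (diag_block_mat [1\<^sub>m na, 0\<^sub>m nb nb])"

definition T_mat :: "complex mat \<Rightarrow> complex mat \<Rightarrow> complex mat \<Rightarrow> complex mat" where
  "T_mat Z1 Z2 Z3 =
     diag_block_mat [Z3, map_mat cnj Z3] @\<^sub>c
     diag_block_mat [Z1, map_mat cnj Z1] @\<^sub>c
     diag_block_mat [Z2, map_mat cnj Z2]"

definition Vtilde_mat :: "nat \<Rightarrow> nat \<Rightarrow> nat \<Rightarrow> nat \<Rightarrow> complex mat" where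
  "Vtilde_mat n1 n2 na nb =
     diag_block_mat [Pi_mat na nb * V_mat (na + nb), V_mat n1, V_mat n2]"

text \<open>The coordinates are ordered as \<open>q_h\<close>, \<open>p_h\<close>, \<open>x_co\<close>, and the uncontrollable
  and unobservable ones, of lengths \<open>n3\<close>, \<open>n3\<close>, \<open>2 * n1\<close> and \<open>2 * n2\<close>.
  The transformed system matrices have real entries and are therefore taken in the type
  of real matrices, so that the two subspaces are subspaces of a real coordinate space.\<close>

definition kalman_canonical_form ::
  "nat \<Rightarrow> nat \<Rightarrow> nat \<Rightarrow> nat \<Rightarrow> complex mat \<Rightarrow> complex mat \<Rightarrow> complex mat \<Rightarrow>
   real mat \<Rightarrow> real mat \<Rightarrow> real mat \<Rightarrow> bool" where
  "kalman_canonical_form n1 n2 n3 m A B C Abar Bbar Cbar \<longleftrightarrow>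
     (let n = n1 + n2 + n3 in
      (\<exists>Z1 Z2 Z3 na nb T That.
        Z1 \<in> carrier_mat n n1 \<and> Z2 \<in> carrier_mat n n2 \<and> Z3 \<in> carrier_mat n n3 \<and>
        T = T_mat Z1 Z2 Z3 \<and>
        unitary_mat (2 * n) T \<and>
        mat_adjoint T * J_mat n * T = diag_block_mat [J_mat n3, J_mat n1, J_mat n2] \<and>
        n3 = na + nb \<and>
        That = T * mat_adjoint (Vtilde_mat n1 n2 na nb) \<and>
        map_mat complex_of_real Abar = mat_adjoint That * A * That \<and>
        map_mat complex_of_real Bbar = mat_adjoint That * B * mat_adjoint (V_mat m) \<and>
        map_mat complex_of_real Cbar = V_mat m * C * That) \<and>
      controllable_subspace Abar Bbar =
        coordinate_span (2 * n) ({0..<n3} \<union> {2 * n3..<2 * n3 + 2 * n1}) \<and>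
      unobservable_subspace Abar Cbar =
        coordinate_span (2 * n) ({0..<n3} \<union> {2 * n3 + 2 * n1..<2 * n}))"

end

theory Submission
  imports Defs
begin

text \<open>
  Physical realizability of a quantum linear system is expressed by
  \<open>A J + J A\<^sup>\<dagger> + B J B\<^sup>\<dagger> = 0\<close> and \<open>B = - J C\<^sup>\<dagger> J\<close>, which follow from
  \<open>A = - i J \<Omega> - C\<^sup>\<flat> C / 2\<close> since \<open>\<Omega>\<close> is Hermitian. The Kalman transformation is
  unitary and carries \<open>J\<close> to \<open>i K\<close>, where \<open>K\<close> is block diagonal with symplectic
  blocks: \<open>V J V\<^sup>\<dagger> = i \<J>\<close>, and \<open>\<Pi>\<close> is orthogonal and symplectic. In the real
  coordinates the two conditions therefore become \<open>A K + K A\<^sup>T + B \<J> B\<^sup>T = 0\<close> and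
  \<open>B = K C\<^sup>T \<J>\<close>. The claimed identities are the blocks of these two equations,
  multiplied by symplectic matrices where necessary.
\<close>

section \<open>Matrices\<close>

text \<open>The hypotheses equate dimensions instead of naming carriers, so no intermediate size is
  left to guess. The law can thus serve as a rewrite rule, with side conditions settled by the
  dimension rules. The following laws have this form for the same reason.\<close>

lemma mult_assoc_dim:
  fixes A B C :: "'a :: semiring_0 mat"
  assumes "dim_col A = dim_row B" "dim_col B = dim_row C"
  shows "A * B * C = A * (B * C)"
  using assms by (intro assoc_mult_mat[where n\<^sub>1 = "dim_row A" and n\<^sub>2 = "dim_row B"
    and n\<^sub>3 = "dim_row C" and n\<^sub>4 = "dim_col C"]) auto

lemma mult_add_distrib_dim:
  fixes A B C :: "'a :: semiring_0 mat"
  assumes "dim_col A = dim_row B" "dim_row B = dim_row C" "dim_col B = dim_col C"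
  shows "A * (B + C) = A * B + A * C"
  using assms
  by (intro mult_add_distrib_mat[of _ "dim_row A" "dim_row C" _ "dim_col C"] carrier_matI) auto

lemma add_mult_distrib_dim:
  fixes A B C :: "'a :: semiring_0 mat"
  assumes "dim_col A = dim_row C" "dim_row A = dim_row B" "dim_col A = dim_col B"
  shows "(A + B) * C = A * C + B * C"
  using assms
  by (intro add_mult_distrib_mat[of _ "dim_row B" "dim_row C" _ _ "dim_col C"] carrier_matI) auto

lemma smult_add_dim:
  fixes A B :: "'a :: semiring mat"
  assumes "dim_row A = dim_row B" "dim_col A = dim_col B"
  shows "a \<cdot>\<^sub>m (A + B) = a \<cdot>\<^sub>m A + a \<cdot>\<^sub>m B"
  using assms by (intro eq_matI) (auto simp: distrib_left)

lemma smult_mult_dim: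
  fixes A B :: "'a :: comm_semiring_0 mat"
  assumes "dim_col A = dim_row B"
  shows "(a \<cdot>\<^sub>m A) * B = a \<cdot>\<^sub>m (A * B)" "A * (a \<cdot>\<^sub>m B) = a \<cdot>\<^sub>m (A * B)"
  using assms by (auto intro!: eq_matI)

lemma smult_smult_mat:
  fixes A :: "'a :: semigroup_mult mat"
  shows "a \<cdot>\<^sub>m (b \<cdot>\<^sub>m A) = (a * b) \<cdot>\<^sub>m A"
  by (intro eq_matI) (auto simp: mult.assoc)

lemma smult_mult_smult:
  fixes A B :: "'a :: comm_semiring_0 mat"
  assumes "dim_col A = dim_row B"
  shows "(a \<cdot>\<^sub>m A) * (b \<cdot>\<^sub>m B) = (a * b) \<cdot>\<^sub>m (A * B)"
  using assms by (intro eq_matI) (auto simp: mult_ac)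

text \<open>Long products are normalised to right-nested form; this form removes an inverse pair
  from the middle of such a product.\<close>

lemma mult_cancel_inverse:
  fixes A B C :: "'a :: semiring_1 mat"
  assumes "A * B = 1\<^sub>m k" "dim_col A = dim_row B" "dim_col B = dim_row C"
  shows "A * (B * C) = C"
proof -
  have "A * (B * C) = A * B * C"
    using assms by (intro mult_assoc_dim[symmetric]) auto
  moreover have "dim_row C = k"
    using assms(1,3) by (metis index_mult_mat(3) index_one_mat(3))
  ultimately show ?thesis
    using assms(1) by simp
qed

lemma add_zero_mat_dim:
  fixes A :: "'a :: monoid_add mat"
  assumes "dim_row A = r" "dim_col A = c"
  shows "A + 0\<^sub>m r c = A" "0\<^sub>m r c + A = A"
  using assms by (auto intro!: eq_matI)

lemma uminus_zero_mat: "- 0\<^sub>m r c = (0\<^sub>m r c :: 'a :: group_add mat)"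
  by (intro eq_matI) auto

lemma add_eq_zero_mat_imp:
  fixes A B :: "'a :: group_add mat"
  assumes "A + B = 0\<^sub>m r c" "dim_row A = dim_row B" "dim_col A = dim_col B"
  shows "B = - A"
  using assms by (auto simp: mat_eq_iff intro!: minus_unique[symmetric])

section \<open>Block matrices\<close>

lemma dim_append_cols [simp]:
  "dim_row (A @\<^sub>c B) = dim_row A" "dim_col (A @\<^sub>c B) = dim_col A + dim_col B"
  by (simp_all add: append_cols_def)

lemma dim_append_rows [simp]:
  "dim_row (A @\<^sub>r B) = dim_row A + dim_row B" "dim_col (A @\<^sub>r B) = dim_col A"
  by (simp_all add: append_rows_def)

lemma index_append_cols:
  assumes "i < dim_row A" "j < dim_col A + dim_col B"
  shows "(A @\<^sub>c B) $$ (i, j) = (if j < dim_col A then A $$ (i, j) else B $$ (i, j - dim_col A))"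
  using assms by (simp add: append_cols_def)

lemma index_append_rows:
  assumes "i < dim_row A + dim_row B" "j < dim_col A"
  shows "(A @\<^sub>r B) $$ (i, j) = (if i < dim_row A then A $$ (i, j) else B $$ (i - dim_row A, j))"
  using assms by (simp add: append_rows_def)

text \<open>Both sides are cut after the same column, so block equations can be read off. For the
  right parts, entries are compared with the column index shifted by
  \<open>dim_col A\<close>.\<close>

lemma append_cols_eq_iff:
  assumes "dim_row A = dim_row B" "dim_row A' = dim_row B'"
    "dim_col A = dim_col A'"
  shows "A @\<^sub>c B = A' @\<^sub>c B' \<longleftrightarrow> A = A' \<and> B = B'"
proof
  assume eq: "A @\<^sub>c B = A' @\<^sub>c B'"
  have r: "dim_row A = dim_row A'"
    using arg_cong[OF eq, of dim_row] by simp
  have c: "dim_col B = dim_col B'"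
    using arg_cong[OF eq, of dim_col] assms by simp
  have ix: "(A @\<^sub>c B) $$ (i, j) = (A' @\<^sub>c B') $$ (i, j)" for i j
    by (simp add: eq)
  show "A = A' \<and> B = B'"
  proof
    show "A = A'"
    proof (rule eq_matI)
      fix i j assume "i < dim_row A'" "j < dim_col A'"
      thus "A $$ (i, j) = A' $$ (i, j)"
        using ix[of i j] assms r c by (simp add: index_append_cols)
    qed (use assms r in auto)
    show "B = B'"
    proof (rule eq_matI)
      fix i j assume "i < dim_row B'" "j < dim_col B'"
      thus "B $$ (i, j) = B' $$ (i, j)"
        using ix[of i "dim_col A + j"] assms r c by (simp add: index_append_cols)
    qed (use assms r c in auto)
  qed
qed simp

lemma transpose_append_cols:
  assumes "dim_row A = dim_row B"
  shows "(A @\<^sub>c B)\<^sup>T = A\<^sup>T @\<^sub>r B\<^sup>T"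
  using assms by (intro eq_matI) (auto simp: index_append_cols index_append_rows)

lemma transpose_append_rows:
  assumes "dim_col A = dim_col B"
  shows "(A @\<^sub>r B)\<^sup>T = A\<^sup>T @\<^sub>c B\<^sup>T"
  using assms by (intro eq_matI) (auto simp: index_append_cols index_append_rows)

lemma append_rows_eq_iff:
  assumes "dim_col A = dim_col B" "dim_col A' = dim_col B'" "dim_row A = dim_row A'"
  shows "A @\<^sub>r B = A' @\<^sub>r B' \<longleftrightarrow> A = A' \<and> B = B'"
proof -
  have "A @\<^sub>r B = A' @\<^sub>r B' \<longleftrightarrow> (A @\<^sub>r B)\<^sup>T = (A' @\<^sub>r B')\<^sup>T"
    by (metis transpose_transpose)
  also have "\<dots> \<longleftrightarrow> A\<^sup>T = A'\<^sup>T \<and> B\<^sup>T = B'\<^sup>T"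
    using assms by (simp add: transpose_append_rows append_cols_eq_iff)
  also have "\<dots> \<longleftrightarrow> A = A' \<and> B = B'"
    by (metis transpose_transpose)
  finally show ?thesis .
qed

lemma append_cols_assoc:
  assumes "dim_row A = dim_row B" "dim_row B = dim_row C"
  shows "(A @\<^sub>c B) @\<^sub>c C = A @\<^sub>c B @\<^sub>c C"
  using assms by (intro eq_matI) (auto simp: index_append_cols diff_diff_left)

lemma append_rows_assoc:
  assumes "dim_col A = dim_col B" "dim_col B = dim_col C"
  shows "(A @\<^sub>r B) @\<^sub>r C = A @\<^sub>r B @\<^sub>r C"
  using assms by (intro eq_matI) (auto simp: index_append_rows diff_diff_left)

text \<open>This interchange law matters later: \<open>Abar * K\<close> comes out as rows of blocks,
  but \<open>K * Abar\<^sup>T\<close> as columns of blocks, and they can be added only after being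
  brought to one shape.\<close>

lemma append_rows_append_cols:
  assumes "dim_row A = dim_row B" "dim_row C = dim_row D" "dim_col A = dim_col C" "dim_col B = dim_col D"
  shows "(A @\<^sub>c B) @\<^sub>r (C @\<^sub>c D) = (A @\<^sub>r C) @\<^sub>c (B @\<^sub>r D)"
  using assms by (intro eq_matI) (auto simp: index_append_cols index_append_rows)

lemma zero_mat_append_cols: "0\<^sub>m r (c + d) = 0\<^sub>m r c @\<^sub>c 0\<^sub>m r d"
  by (intro eq_matI) (auto simp: index_append_cols)

lemma zero_mat_append_rows: "0\<^sub>m (r + s) c = 0\<^sub>m r c @\<^sub>r 0\<^sub>m s c"
  by (intro eq_matI) (auto simp: index_append_rows)

lemma add_append_cols:
  assumes "dim_row A = dim_row B" "dim_row A' = dim_row B'" "dim_row A = dim_row A'"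
    "dim_col A = dim_col A'" "dim_col B = dim_col B'"
  shows "(A @\<^sub>c B) + (A' @\<^sub>c B') = (A + A') @\<^sub>c (B + B')"
  using assms by (intro eq_matI) (auto simp: index_append_cols)

lemma add_append_rows:
  assumes "dim_row A = dim_row A'" "dim_row B = dim_row B'" "dim_col A = dim_col B"
    "dim_col A = dim_col A'" "dim_col B = dim_col B'"
  shows "(A @\<^sub>r B) + (A' @\<^sub>r B') = (A + A') @\<^sub>r (B + B')"
  using assms by (intro eq_matI) (auto simp: index_append_rows)

lemma mult_append_cols:
  assumes "dim_col M = dim_row A" "dim_row A = dim_row B"
  shows "M * (A @\<^sub>c B) = M * A @\<^sub>c M * B"
  unfolding append_cols_def using assms
  by (intro eq_matI) (auto simp: scalar_prod_def intro!: sum.cong)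

lemma append_rows_mult:
  assumes "dim_col A = dim_row M" "dim_col A = dim_col B"
  shows "(A @\<^sub>r B) * M = A * M @\<^sub>r B * M"
  unfolding append_rows_def using assms
  by (intro eq_matI) (auto simp: scalar_prod_def intro!: sum.cong)

text \<open>A row of the left factor and a column of the right factor are concatenations cut at the
  same place, so their scalar product splits into two.\<close>

lemma append_cols_mult_append_rows:
  fixes A B C D :: "'a :: semiring_0 mat"
  assumes "dim_row A = dim_row B" "dim_col C = dim_col D" "dim_col A = dim_row C" "dim_col B = dim_row D"
  shows "(A @\<^sub>c B) * (C @\<^sub>r D) = A * C + B * D"
proof (rule eq_matI)
  fix i j assume "i < dim_row (A * C + B * D)" "j < dim_col (A * C + B * D)"
  hence ij: "i < dim_row B" "j < dim_col D" by auto
  have "row (A @\<^sub>c B) i = row A i @\<^sub>v row B i"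
    using ij assms by (intro eq_vecI) (auto simp: index_append_cols)
  moreover have "col (C @\<^sub>r D) j = col C j @\<^sub>v col D j"
    using ij assms by (intro eq_vecI) (auto simp: index_append_rows)
  ultimately show "((A @\<^sub>c B) * (C @\<^sub>r D)) $$ (i, j) = (A * C + B * D) $$ (i, j)"
    using ij assms scalar_prod_append[of "row A i" "dim_row C" "row B i" "dim_row D" "col C j" "col D j"]
    by (simp add: carrier_vecI)
qed (use assms in auto)

section \<open>Block diagonal matrices\<close>

lemma diag_block_mat_Cons:
  "diag_block_mat (A # As) =
     (A @\<^sub>c 0\<^sub>m (dim_row A) (dim_col (diag_block_mat As))) @\<^sub>r
     (0\<^sub>m (dim_row (diag_block_mat As)) (dim_col A) @\<^sub>c diag_block_mat As)"
  by (intro eq_matI) (auto simp: index_append_cols index_append_rows Let_def)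

text \<open>Peeling off the first blocks leaves a product of two-by-two block matrices whose mixed
  terms contain a zero factor. The pairwise condition also forces lists of equal length, so that
  zipping truncates nothing.\<close>

lemma diag_block_mat_mult:
  fixes As Bs :: "'a :: semiring_0 mat list"
  assumes "list_all2 (\<lambda>X Y. dim_col X = dim_row Y) As Bs"
  shows "diag_block_mat As * diag_block_mat Bs = diag_block_mat (map2 (*) As Bs)"
  using assms
proof (induction rule: list_all2_induct)
  case (Cons A As B Bs)
  have [simp]: "dim_col (diag_block_mat As) = dim_row (diag_block_mat Bs)"
    using Cons.hyps(2) by (induction rule: list_all2_induct) (auto simp: Let_def)
  \<comment> \<open>Read backwards, the induction hypothesis turns the right-hand matrices into
    products, whose dimensions are known.\<close>
  have [simp]: "dim_row (diag_block_mat As) = dim_row (diag_block_mat (map2 (*) As Bs))"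
    "dim_col (diag_block_mat Bs) = dim_col (diag_block_mat (map2 (*) As Bs))"
    by (simp_all flip: Cons.IH)
  show ?case
    using Cons.hyps(1)
    by (simp add: diag_block_mat_Cons append_rows_mult append_cols_mult_append_rows mult_append_cols
       add_append_cols add_zero_mat_dim Cons.IH del: diag_block_mat.simps(2))
qed simp

text \<open>Used repeatedly, this and its row counterpart multiply by
  \<open>diag_block_mat [\<J> n3, \<J> n1, \<J> n2]\<close> one block at a time.\<close>

lemma append_cols_mult_diag_block_mat:
  fixes X Y A :: "'a :: semiring_0 mat"
  assumes "dim_col X = dim_row A" "dim_col Y = dim_row (diag_block_mat As)" "dim_row X = dim_row Y"
  shows "(X @\<^sub>c Y) * diag_block_mat (A # As) = X * A @\<^sub>c Y * diag_block_mat As"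
  using assms by (simp add: diag_block_mat_Cons append_cols_mult_append_rows mult_append_cols
    add_append_cols add_zero_mat_dim del: diag_block_mat.simps)

lemma diag_block_mat_mult_append_rows:
  fixes X Y A :: "'a :: semiring_0 mat"
  assumes "dim_row X = dim_col A" "dim_row Y = dim_col (diag_block_mat As)" "dim_col X = dim_col Y"
  shows "diag_block_mat (A # As) * (X @\<^sub>r Y) = A * X @\<^sub>r diag_block_mat As * Y"
  using assms by (simp add: diag_block_mat_Cons append_cols_mult_append_rows append_rows_mult
    add_zero_mat_dim del: diag_block_mat.simps)

lemma smult_diag_block_mat:
  fixes a :: "'a :: semiring_0"
  shows "a \<cdot>\<^sub>m diag_block_mat As = diag_block_mat (map ((\<cdot>\<^sub>m) a) As)"
proof (induction As)
  case (Cons A As)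
  show ?case
    unfolding list.map diag_block_mat.simps Let_def Cons.IH[symmetric]
    by (intro eq_matI) auto
qed auto

lemma map_diag_block_mat:
  assumes "f 0 = 0"
  shows "map_mat f (diag_block_mat As) = diag_block_mat (map (map_mat f) As)"
proof (induction As)
  case (Cons A As)
  show ?case
    unfolding list.map diag_block_mat.simps Let_def Cons.IH[symmetric]
    by (intro eq_matI) (auto simp: assms)
qed auto

section \<open>Adjoints and real matrices\<close>

lemma dim_mat_adjoint [simp]:
  fixes A :: "complex mat"
  shows "dim_row (mat_adjoint A) = dim_col A" "dim_col (mat_adjoint A) = dim_row A"
  by (simp_all add: mat_adjoint_eq_transpose_cnj)

lemma mat_adjoint_adjoint [simp]: "mat_adjoint (mat_adjoint (A :: complex mat)) = A"
  by (intro eq_matI) (auto simp: mat_adjoint_eq_transpose_cnj)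

lemma mat_adjoint_one: "mat_adjoint (1\<^sub>m k :: complex mat) = 1\<^sub>m k"
  by (intro eq_matI) (auto simp: mat_adjoint_eq_transpose_cnj)

lemma mat_adjoint_zero: "mat_adjoint (0\<^sub>m r c :: complex mat) = 0\<^sub>m c r"
  by (intro eq_matI) (auto simp: mat_adjoint_eq_transpose_cnj)

lemma mat_adjoint_uminus: "mat_adjoint (- A :: complex mat) = - mat_adjoint A"
  by (intro eq_matI) (auto simp: mat_adjoint_eq_transpose_cnj)

lemma mat_adjoint_add:
  fixes A B :: "complex mat"
  assumes "dim_row A = dim_row B" "dim_col A = dim_col B"
  shows "mat_adjoint (A + B) = mat_adjoint A + mat_adjoint B"
  using assms by (intro eq_matI) (auto simp: mat_adjoint_eq_transpose_cnj)

lemma mat_adjoint_smult: "mat_adjoint (a \<cdot>\<^sub>m A) = cnj a \<cdot>\<^sub>m mat_adjoint A"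
  by (intro eq_matI) (auto simp: mat_adjoint_eq_transpose_cnj)

lemma mat_adjoint_mult:
  fixes A B :: "complex mat"
  assumes "dim_col A = dim_row B"
  shows "mat_adjoint (A * B) = mat_adjoint B * mat_adjoint A"
  using assms
  by (intro eq_matI)
    (auto simp: mat_adjoint_eq_transpose_cnj scalar_prod_def cnj_sum mult.commute intro!: sum.cong)

lemma mat_adjoint_four_block:
  fixes A B C D :: "complex mat"
  assumes "A \<in> carrier_mat nr1 nc1" "B \<in> carrier_mat nr1 nc2"
    "C \<in> carrier_mat nr2 nc1" "D \<in> carrier_mat nr2 nc2"
  shows "mat_adjoint (four_block_mat A B C D) =
    four_block_mat (mat_adjoint A) (mat_adjoint C) (mat_adjoint B) (mat_adjoint D)"
  using assms by (intro eq_matI) (auto simp: mat_adjoint_eq_transpose_cnj)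

lemma mat_adjoint_diag_block_mat:
  fixes As :: "complex mat list"
  shows "mat_adjoint (diag_block_mat As) = diag_block_mat (map mat_adjoint As)"
proof (induction As)
  case (Cons A As)
  show ?case
    unfolding list.map diag_block_mat.simps Let_def Cons.IH[symmetric]
    by (intro eq_matI) (auto simp: mat_adjoint_eq_transpose_cnj)
qed (auto simp: mat_adjoint_eq_transpose_cnj)

text \<open>This is where the adjoints of the complex model become the transposes of the real
  canonical form.\<close>

lemma mat_adjoint_map_of_real:
  "mat_adjoint (map_mat complex_of_real X) = map_mat complex_of_real X\<^sup>T"
  by (intro eq_matI) (auto simp: mat_adjoint_eq_transpose_cnj)

lemma map_mat_of_real_add:
  assumes "dim_row X = dim_row Y" "dim_col X = dim_col Y"
  shows "map_mat complex_of_real (X + Y) = map_mat complex_of_real X + map_mat complex_of_real Y"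
  using assms by (intro eq_matI) auto

lemma map_mat_of_real_mult:
  assumes "dim_col X = dim_row Y"
  shows "map_mat complex_of_real (X * Y) = map_mat complex_of_real X * map_mat complex_of_real Y"
  using assms by (intro of_real_hom.mat_hom_mult[of _ "dim_row X" "dim_col X" _ "dim_col Y"]) auto

section \<open>Real coordinates\<close>

text \<open>The Kronecker product of a complex 2 by 2 matrix with the identity of size
  \<open>k\<close>. \<open>J_mat\<close>, \<open>V_mat\<close> (up to its scalar factor) and the
  symplectic matrix all have this form, so identities between them reduce to 2 by 2
  arithmetic.\<close>

definition scalar_blocks :: "nat \<Rightarrow> complex \<Rightarrow> complex \<Rightarrow> complex \<Rightarrow> complex \<Rightarrow> complex mat" where
  "scalar_blocks k a b c d =
     four_block_mat (a \<cdot>\<^sub>m 1\<^sub>m k) (b \<cdot>\<^sub>m 1\<^sub>m k) (c \<cdot>\<^sub>m 1\<^sub>m k) (d \<cdot>\<^sub>m 1\<^sub>m k)"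

lemma dim_scalar_blocks [simp]:
  "dim_row (scalar_blocks k a b c d) = 2 * k" "dim_col (scalar_blocks k a b c d) = 2 * k"
  by (simp_all add: scalar_blocks_def)

lemma scalar_blocks_mult:
  "scalar_blocks k a b c d * scalar_blocks k a' b' c' d' =
     scalar_blocks k (a * a' + b * c') (a * b' + b * d') (c * a' + d * c') (c * b' + d * d')"
proof -
  have "(x \<cdot>\<^sub>m 1\<^sub>m k) * (y \<cdot>\<^sub>m 1\<^sub>m k) = (x * y) \<cdot>\<^sub>m 1\<^sub>m k" for x y :: complex
    by (subst smult_mult_smult) simp_all
  moreover have "(x \<cdot>\<^sub>m 1\<^sub>m k) + (y \<cdot>\<^sub>m 1\<^sub>m k) = (x + y) \<cdot>\<^sub>m 1\<^sub>m k" for x y :: complex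
    by (rule add_smult_distrib_right_mat[symmetric, of _ k k]) simp
  ultimately show ?thesis
    unfolding scalar_blocks_def
    by (subst mult_four_block_mat[of _ k k _ k _ k _ _ k _ k]) (simp_all only: smult_carrier_mat one_carrier_mat)
qed

lemma mat_adjoint_scalar_blocks:
  "mat_adjoint (scalar_blocks k a b c d) = scalar_blocks k (cnj a) (cnj c) (cnj b) (cnj d)"
  by (intro eq_matI) (auto simp: mat_adjoint_eq_transpose_cnj scalar_blocks_def)

lemma smult_scalar_blocks:
  "x \<cdot>\<^sub>m scalar_blocks k a b c d = scalar_blocks k (x * a) (x * b) (x * c) (x * d)"
  by (intro eq_matI) (auto simp: scalar_blocks_def)

lemma one_mat_scalar_blocks: "1\<^sub>m (2 * k) = scalar_blocks k 1 0 0 1"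
  by (intro eq_matI) (auto simp: scalar_blocks_def)

lemma J_mat_scalar_blocks: "J_mat k = scalar_blocks k 1 0 0 (- 1)"
  by (intro eq_matI) (auto simp: J_mat_def scalar_blocks_def Let_def)

lemma V_mat_scalar_blocks:
  "V_mat k = complex_of_real (1 / sqrt 2) \<cdot>\<^sub>m scalar_blocks k 1 1 (- \<i>) \<i>"
  by (intro eq_matI) (auto simp: V_mat_def scalar_blocks_def)

section \<open>The transformation to quadratures\<close>

abbreviation complex_symp_mat :: "nat \<Rightarrow> complex mat" where
  "complex_symp_mat k \<equiv> map_mat complex_of_real (\<J> k)"

lemma complex_symp_mat_scalar_blocks:
  "complex_symp_mat k = scalar_blocks k 0 1 (- 1) 0"
  by (intro eq_matI) (auto simp: symp_mat_def scalar_blocks_def)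

lemma dim_J_mat [simp]: "dim_row (J_mat k) = 2 * k" "dim_col (J_mat k) = 2 * k"
  by (simp_all add: J_mat_scalar_blocks)

lemma dim_symp_mat [simp]: "dim_row (\<J> k) = 2 * k" "dim_col (\<J> k) = 2 * k"
  by (simp_all add: symp_mat_def)

lemma dim_V_mat [simp]: "dim_row (V_mat k) = 2 * k" "dim_col (V_mat k) = 2 * k"
  by (simp_all add: V_mat_def)

lemma dim_Pi_mat [simp]:
  "dim_row (Pi_mat a b) = 2 * (a + b)" "dim_col (Pi_mat a b) = 2 * (a + b)"
  by (simp_all add: Pi_mat_def dim_diag_block_mat)

lemma dim_Vtilde_mat [simp]:
  "dim_row (Vtilde_mat n1 n2 a b) = 2 * (a + b) + (2 * n1 + 2 * n2)"
  "dim_col (Vtilde_mat n1 n2 a b) = 2 * (a + b) + (2 * n1 + 2 * n2)"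
  by (simp_all add: Vtilde_mat_def dim_diag_block_mat)

lemma mat_adjoint_J_mat: "mat_adjoint (J_mat k) = J_mat k"
  by (simp add: J_mat_scalar_blocks mat_adjoint_scalar_blocks)

lemma J_mat_square: "J_mat k * J_mat k = 1\<^sub>m (2 * k)"
  by (simp add: J_mat_scalar_blocks one_mat_scalar_blocks scalar_blocks_mult)

lemma inverse_sqrt2_square: "complex_of_real (1 / sqrt 2) * complex_of_real (1 / sqrt 2) = 1 / 2"
  by (simp flip: of_real_mult)

text \<open>Without its scalar factor, the 2 by 2 matrix of \<open>V_mat\<close> has orthogonal
  columns of squared norm 2; the square of 1 / sqrt 2 normalises them.\<close>

lemma V_mat_adjoint_mult: "mat_adjoint (V_mat k) * V_mat k = 1\<^sub>m (2 * k)"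
  unfolding V_mat_scalar_blocks mat_adjoint_smult complex_cnj_complex_of_real
  by (subst smult_mult_smult, simp)
    (simp add: inverse_sqrt2_square mat_adjoint_scalar_blocks scalar_blocks_mult
      smult_scalar_blocks one_mat_scalar_blocks del: of_real_divide)

lemma V_mat_J_mat: "V_mat k * J_mat k * mat_adjoint (V_mat k) = \<i> \<cdot>\<^sub>m complex_symp_mat k"
proof -
  let ?c = "complex_of_real (1 / sqrt 2)" and ?S = "scalar_blocks k 1 1 (- \<i>) \<i>"
  have "V_mat k * J_mat k = ?c \<cdot>\<^sub>m (?S * J_mat k)"
    unfolding V_mat_scalar_blocks
    by (rule mult_smult_assoc_mat[of _ "2 * k" "2 * k" _ "2 * k"]) (auto intro!: carrier_matI)
  moreover have "mat_adjoint (V_mat k) = ?c \<cdot>\<^sub>m mat_adjoint ?S"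
    unfolding V_mat_scalar_blocks mat_adjoint_smult complex_cnj_complex_of_real ..
  \<comment> \<open>The root is kept unevaluated until both copies are collected and their product
    can be replaced by 1 / 2.\<close>
  ultimately have "V_mat k * J_mat k * mat_adjoint (V_mat k) = (?c * ?c) \<cdot>\<^sub>m (?S * J_mat k * mat_adjoint ?S)"
    by (simp only:) (rule smult_mult_smult, simp)
  also have "\<dots> = \<i> \<cdot>\<^sub>m complex_symp_mat k"
    unfolding inverse_sqrt2_square
    by (simp add: mat_adjoint_scalar_blocks scalar_blocks_mult
      smult_scalar_blocks complex_symp_mat_scalar_blocks J_mat_scalar_blocks)
  finally show ?thesis .
qed

text \<open>\<open>Pi_mat\<close> has rows of blocks (E, -F) and (F, E) with complementary
  projections E and F. Orthogonality follows from E + F = 1 and E F = F E = 0. Any matrix of this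
  block pattern commutes with the symplectic matrix, so an orthogonal one preserves it under
  conjugation.\<close>

lemma Pi_mat_orthogonal:
  "mat_adjoint (Pi_mat a b) * Pi_mat a b = 1\<^sub>m (2 * (a + b))"
  "Pi_mat a b * complex_symp_mat (a + b) * mat_adjoint (Pi_mat a b) = complex_symp_mat (a + b)"
proof -
  define E F :: "complex mat" where "E = diag_block_mat [1\<^sub>m a, 0\<^sub>m b b]"
    and "F = diag_block_mat [0\<^sub>m a a, 1\<^sub>m b]"
  define k where "k = a + b"
  have carr [simp]: "E \<in> carrier_mat k k" "F \<in> carrier_mat k k"
    by (auto simp: E_def F_def k_def Let_def)
  have dims [simp]: "dim_row E = k" "dim_col E = k" "dim_row F = k" "dim_col F = k"
    using carr unfolding carrier_mat_def by blast+
  have EF [simp]: "E * E = E" "F * F = F" "E * F = 0\<^sub>m k k" "F * E = 0\<^sub>m k k"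
    unfolding E_def F_def
    by (subst diag_block_mat_mult; auto simp: k_def Let_def intro!: eq_matI)+
  have sum [simp]: "E + F = 1\<^sub>m k" "F + E = 1\<^sub>m k"
    by (auto simp: E_def F_def k_def Let_def intro!: eq_matI)
  have EF_adj: "mat_adjoint E = E" "mat_adjoint F = F"
    unfolding E_def F_def mat_adjoint_diag_block_mat
    by (simp_all add: mat_adjoint_one mat_adjoint_zero del: diag_block_mat.simps)
  have Pi: "Pi_mat a b = four_block_mat E (- F) F E"
    unfolding Pi_mat_def E_def F_def
    by (intro cong_four_block_mat eq_matI) (auto simp: Let_def)
  have adj: "mat_adjoint (Pi_mat a b) = four_block_mat E F (- F) E"
    unfolding Pi
    by (subst mat_adjoint_four_block[of _ k k _ k _ k])
      (simp_all add: mat_adjoint_uminus EF_adj)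
  have symp: "complex_symp_mat k = four_block_mat (0\<^sub>m k k) (1\<^sub>m k) (- 1\<^sub>m k) (0\<^sub>m k k)"
    by (intro eq_matI) (auto simp: symp_mat_def)
  have one: "1\<^sub>m (2 * k) = four_block_mat (1\<^sub>m k) (0\<^sub>m k k) (0\<^sub>m k k) (1\<^sub>m k :: complex mat)"
    by (simp add: mult_2)
  note blocks = mult_four_block_mat[where ?nr1.0 = k and ?n1.0 = k and ?n2.0 = k and ?nr2.0 = k
    and ?nc1.0 = k and ?nc2.0 = k]
  have PiPi: "mat_adjoint (Pi_mat a b) * Pi_mat a b = 1\<^sub>m (2 * k)"
    unfolding adj one unfolding Pi
    by (subst blocks) (simp_all add: add_zero_mat_dim uminus_zero_mat)
  have orth: "Pi_mat a b * mat_adjoint (Pi_mat a b) = 1\<^sub>m (2 * k)"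
    unfolding adj one unfolding Pi
    by (subst blocks) (simp_all add: add_zero_mat_dim uminus_zero_mat)
  \<comment> \<open>Commutation is shown by computing both products explicitly.\<close>
  have "Pi_mat a b * complex_symp_mat k = four_block_mat F E (- E) F"
    unfolding symp Pi
    by (subst blocks) (simp_all add: add_zero_mat_dim uminus_zero_mat)
  moreover have "complex_symp_mat k * Pi_mat a b = four_block_mat F E (- E) F"
    unfolding symp Pi
    by (subst blocks) (simp_all add: add_zero_mat_dim uminus_zero_mat)
  ultimately have "Pi_mat a b * complex_symp_mat k * mat_adjoint (Pi_mat a b) =
      complex_symp_mat k * Pi_mat a b * mat_adjoint (Pi_mat a b)"
    by (simp only:)
  also have "\<dots> = complex_symp_mat k * (Pi_mat a b * mat_adjoint (Pi_mat a b))"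
    by (rule mult_assoc_dim) (simp_all add: k_def)
  finally have "Pi_mat a b * complex_symp_mat k * mat_adjoint (Pi_mat a b) = complex_symp_mat k"
    by (simp add: orth)
  with PiPi show "mat_adjoint (Pi_mat a b) * Pi_mat a b = 1\<^sub>m (2 * (a + b))"
    "Pi_mat a b * complex_symp_mat (a + b) * mat_adjoint (Pi_mat a b) = complex_symp_mat (a + b)"
    by (simp_all add: k_def)
qed

text \<open>This order of the factors is the one that meets in the middle of
  \<open>P * mat_adjoint P\<close> when \<open>P\<close> is \<open>T\<close> times the adjoint of
  \<open>Vtilde_mat\<close>.\<close>

lemma Vtilde_mat_unitary:
  "mat_adjoint (Vtilde_mat n1 n2 a b) * Vtilde_mat n1 n2 a b = 1\<^sub>m (2 * (a + b) + (2 * n1 + 2 * n2))"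
proof -
  have "mat_adjoint (Pi_mat a b * V_mat (a + b)) * (Pi_mat a b * V_mat (a + b)) = 1\<^sub>m (2 * (a + b))"
    by (simp add: mat_adjoint_mult mult_assoc_dim mult_cancel_inverse[OF Pi_mat_orthogonal(1)]
      V_mat_adjoint_mult del: distrib_left_numeral)
  thus ?thesis
    unfolding Vtilde_mat_def mat_adjoint_diag_block_mat
    using diag_block_one_mat[of "[1\<^sub>m (2 * (a + b)), 1\<^sub>m (2 * n1), 1\<^sub>m (2 * n2) :: complex mat]"]
    by (subst diag_block_mat_mult)
      (simp_all add: V_mat_adjoint_mult del: diag_block_mat.simps distrib_left_numeral)
qed

lemma Vtilde_mat_J_mat:
  "Vtilde_mat n1 n2 a b * diag_block_mat [J_mat (a + b), J_mat n1, J_mat n2] *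
     mat_adjoint (Vtilde_mat n1 n2 a b) =
   \<i> \<cdot>\<^sub>m map_mat complex_of_real (diag_block_mat [\<J> (a + b), \<J> n1, \<J> n2])"
proof -
  let ?P = "Pi_mat a b" and ?V = "V_mat (a + b)" and ?J = "J_mat (a + b)"
  \<comment> \<open>Regrouping exposes the inner conjugation by \<open>V_mat\<close>, which yields
    the imaginary multiple of the symplectic matrix; the outer one by \<open>Pi_mat\<close> then
    leaves it fixed.\<close>
  have "?P * ?V * ?J * mat_adjoint (?P * ?V) = ?P * ((?V * ?J * mat_adjoint ?V) * mat_adjoint ?P)"
    by (simp add: mat_adjoint_mult mult_assoc_dim)
  also have "\<dots> = \<i> \<cdot>\<^sub>m (?P * complex_symp_mat (a + b) * mat_adjoint ?P)"
    by (simp add: V_mat_J_mat smult_mult_dim mult_assoc_dim)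
  finally have "?P * ?V * ?J * mat_adjoint (?P * ?V) = \<i> \<cdot>\<^sub>m complex_symp_mat (a + b)"
    by (simp add: Pi_mat_orthogonal)
  thus ?thesis
    unfolding Vtilde_mat_def mat_adjoint_diag_block_mat
    by (subst diag_block_mat_mult, simp, subst diag_block_mat_mult)
      (simp_all add: V_mat_J_mat map_diag_block_mat smult_diag_block_mat del: diag_block_mat.simps)
qed

text \<open>The halves \<open>q_h\<close> and \<open>p_h\<close> have separate blocks in the
  canonical form, so the action of \<open>\<J> n3\<close> is needed as a signed swap. For
  \<open>n1\<close> and \<open>n2\<close> the symplectic matrices stay unsplit.\<close>

lemma append_cols_mult_symp_mat:
  assumes "dim_col X = k" "dim_col Y = k" "dim_row X = dim_row Y"
  shows "(X @\<^sub>c Y) * \<J> k = - Y @\<^sub>c X"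
proof -
  have "\<J> k = (0\<^sub>m k k @\<^sub>c 1\<^sub>m k) @\<^sub>r (- 1\<^sub>m k @\<^sub>c 0\<^sub>m k k)"
    by (intro eq_matI) (auto simp: symp_mat_def index_append_cols index_append_rows)
  thus ?thesis
    using assms by (simp add: append_cols_mult_append_rows mult_append_cols add_append_cols
      add_zero_mat_dim)
qed

lemma symp_mat_mult_append_rows:
  assumes "dim_row X = k" "dim_row Y = k" "dim_col X = dim_col Y"
  shows "\<J> k * (X @\<^sub>r Y) = Y @\<^sub>r - X"
proof -
  have "\<J> k = (0\<^sub>m k k @\<^sub>c 1\<^sub>m k) @\<^sub>r (- 1\<^sub>m k @\<^sub>c 0\<^sub>m k k)"
    by (intro eq_matI) (auto simp: symp_mat_def index_append_cols index_append_rows)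
  thus ?thesis
    using assms by (simp add: append_rows_mult append_cols_mult_append_rows add_zero_mat_dim)
qed

lemma symp_mat_square: "\<J> k * \<J> k = - 1\<^sub>m (2 * k)"
proof -
  have "\<J> k = (0\<^sub>m k k @\<^sub>r - 1\<^sub>m k) @\<^sub>c (1\<^sub>m k @\<^sub>r 0\<^sub>m k k)"
    by (intro eq_matI) (auto simp: symp_mat_def index_append_cols index_append_rows)
  moreover have "((0\<^sub>m k k @\<^sub>r - 1\<^sub>m k) @\<^sub>c (1\<^sub>m k @\<^sub>r 0\<^sub>m k k)) * \<J> k =
      - (1\<^sub>m k @\<^sub>r 0\<^sub>m k k) @\<^sub>c (0\<^sub>m k k @\<^sub>r - 1\<^sub>m k)"
    by (rule append_cols_mult_symp_mat) simp_all
  ultimately have "\<J> k * \<J> k = - (1\<^sub>m k @\<^sub>r 0\<^sub>m k k) @\<^sub>c (0\<^sub>m k k @\<^sub>r - 1\<^sub>m k)"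
    by simp
  also have "\<dots> = - 1\<^sub>m (2 * k)"
    by (intro eq_matI) (auto simp: index_append_cols index_append_rows)
  finally show ?thesis .
qed

section \<open>Physical realizability\<close>

text \<open>In \<open>A * J + J * mat_adjoint A\<close> the Hamiltonian parts cancel, because
  \<open>W\<close> and \<open>J_mat\<close> are self-adjoint and the factors -i and i are opposite.
  The two coupling parts contribute -Y/2 each, and \<open>B * J_mat m * mat_adjoint B\<close> equals
  Y, since the square of \<open>J_mat m\<close> is the identity.\<close>

lemma quantum_linear_system_realizable:
  assumes "quantum_linear_system n m A B C"
  shows "A \<in> carrier_mat (2 * n) (2 * n)" "B \<in> carrier_mat (2 * n) (2 * m)"
    "C \<in> carrier_mat (2 * m) (2 * n)"
    "A * J_mat n + J_mat n * mat_adjoint A + B * J_mat m * mat_adjoint B = 0\<^sub>m (2 * n) (2 * n)"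
    "B = - (J_mat n * mat_adjoint C * J_mat m)"
proof -
  from assms obtain Cminus Cplus Wminus Wplus W
    where "Cminus \<in> carrier_mat m n" "Cplus \<in> carrier_mat m n"
      "Wminus \<in> carrier_mat n n" "Wplus \<in> carrier_mat n n"
      "W = \<Delta> Wminus Wplus" and W: "mat_adjoint W = W" and "C = \<Delta> Cminus Cplus"
      and B: "B = - flat_adjoint m n C"
      and A: "A = (- \<i>) \<cdot>\<^sub>m (J_mat n * W) - (1 / 2) \<cdot>\<^sub>m (flat_adjoint m n C * C)"
    unfolding quantum_linear_system_def by auto
  hence dims [simp]: "dim_row W = 2 * n" "dim_col W = 2 * n" "dim_row C = 2 * m" "dim_col C = 2 * n"
    by (simp_all add: doubled_up_def)
  show "B = - (J_mat n * mat_adjoint C * J_mat m)"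
    by (simp add: B flat_adjoint_def)
  show "A \<in> carrier_mat (2 * n) (2 * n)" "B \<in> carrier_mat (2 * n) (2 * m)"
    "C \<in> carrier_mat (2 * m) (2 * n)"
    by (auto intro!: carrier_matI simp: A B flat_adjoint_def)
  define X where "X = J_mat n * (W * J_mat n)"
  define Y where "Y = J_mat n * (mat_adjoint C * (J_mat m * (C * J_mat n)))"
  have [simp]: "dim_row X = 2 * n" "dim_col X = 2 * n" "dim_row Y = 2 * n" "dim_col Y = 2 * n"
    by (simp_all add: X_def Y_def)
  \<comment> \<open>The difference becomes a sum so that the distributive laws above apply.\<close>
  have A': "A = (- \<i>) \<cdot>\<^sub>m (J_mat n * W) + (- 1 / 2) \<cdot>\<^sub>m (flat_adjoint m n C * C)"
    unfolding A by (intro eq_matI) (auto simp: flat_adjoint_def)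
  have "A * J_mat n = (- \<i>) \<cdot>\<^sub>m X + (- 1 / 2) \<cdot>\<^sub>m Y"
    unfolding A' X_def Y_def flat_adjoint_def
    by (simp add: add_mult_distrib_dim smult_mult_dim mult_assoc_dim)
  moreover have "J_mat n * mat_adjoint A = \<i> \<cdot>\<^sub>m X + (- 1 / 2) \<cdot>\<^sub>m Y"
    unfolding A' X_def Y_def flat_adjoint_def
    by (simp add: mat_adjoint_add mat_adjoint_smult mat_adjoint_mult mult_add_distrib_dim
      smult_mult_dim mult_assoc_dim mat_adjoint_J_mat W)
  moreover have "B * J_mat m * mat_adjoint B = Y"
    unfolding B Y_def flat_adjoint_def
    by (simp add: mat_adjoint_uminus mat_adjoint_mult mult_assoc_dim mat_adjoint_J_mat
      mult_cancel_inverse[OF J_mat_square])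
  ultimately show
    "A * J_mat n + J_mat n * mat_adjoint A + B * J_mat m * mat_adjoint B = 0\<^sub>m (2 * n) (2 * n)"
    by (intro eq_matI) (auto simp: algebra_simps)
qed

text \<open>Both complex identities are conjugated by the unitary matrix \<open>P\<close>, inserting
  \<open>P * mat_adjoint P\<close> (and the analogous pair for \<open>V_mat m\<close>) between
  factors. Each \<open>J\<close> then turns into i times a real symplectic matrix.\<close>

lemma kalman_canonical_form_realizable:
  assumes system: "quantum_linear_system (n1 + n2 + n3) m A B C"
    and kalman: "kalman_canonical_form n1 n2 n3 m A B C Abar Bbar Cbar"
  defines "K \<equiv> diag_block_mat [\<J> n3, \<J> n1, \<J> n2]"
  shows "Abar * K + K * Abar\<^sup>T + Bbar * \<J> m * Bbar\<^sup>T =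
      0\<^sub>m (2 * (n1 + n2 + n3)) (2 * (n1 + n2 + n3))"
    "Bbar = K * Cbar\<^sup>T * \<J> m"
proof -
  define N where "N = 2 * (n1 + n2 + n3)"
  define J where "J = J_mat (n1 + n2 + n3)"
  note sys = quantum_linear_system_realizable[OF system, folded N_def J_def]
  have dims [simp]: "dim_row A = N" "dim_col A = N" "dim_row B = N" "dim_col B = 2 * m"
      "dim_row C = 2 * m" "dim_col C = N" "dim_row J = N" "dim_col J = N"
    using sys(1-3) by (auto simp: N_def J_def)
  from kalman obtain Z1 Z2 Z3 na nb T P where
      n3: "n3 = na + nb"
    and T: "unitary_mat N T"
      "mat_adjoint T * J * T = diag_block_mat [J_mat n3, J_mat n1, J_mat n2]"
    and P: "P = T * mat_adjoint (Vtilde_mat n1 n2 na nb)"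
    and bar: "map_mat complex_of_real Abar = mat_adjoint P * A * P"
      "map_mat complex_of_real Bbar = mat_adjoint P * B * mat_adjoint (V_mat m)"
      "map_mat complex_of_real Cbar = V_mat m * C * P"
    unfolding kalman_canonical_form_def Let_def N_def J_def by auto
  let ?c = "map_mat complex_of_real"
  define V where "V = Vtilde_mat n1 n2 na nb"
  have [simp]: "dim_row V = N" "dim_col V = N"
    by (simp_all add: V_def N_def n3)
  have VV: "mat_adjoint V * V = 1\<^sub>m N"
    using Vtilde_mat_unitary[of n1 n2 na nb] by (simp add: V_def N_def n3 algebra_simps)
  have [simp]: "dim_row T = N" "dim_col T = N" and TT: "T * mat_adjoint T = 1\<^sub>m N"
    using T(1) by (auto simp: unitary_mat_def)
  have [simp]: "dim_row P = N" "dim_col P = N"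
    by (simp_all add: P flip: V_def)
  have [simp]: "dim_row K = N" "dim_col K = N"
    by (simp_all add: K_def dim_diag_block_mat N_def)
  have dims_bar [simp]: "dim_row Abar = N" "dim_col Abar = N" "dim_row Bbar = N"
      "dim_col Bbar = 2 * m" "dim_row Cbar = 2 * m" "dim_col Cbar = N"
    using arg_cong[OF bar(1), of dim_row] arg_cong[OF bar(1), of dim_col]
      arg_cong[OF bar(2), of dim_row] arg_cong[OF bar(2), of dim_col]
      arg_cong[OF bar(3), of dim_row] arg_cong[OF bar(3), of dim_col] by simp_all
  have PP: "P * mat_adjoint P = 1\<^sub>m N"
    by (simp add: P mat_adjoint_mult mult_assoc_dim mult_cancel_inverse[OF VV] TT flip: V_def)
  have "mat_adjoint P * J * P = V * (mat_adjoint T * J * T) * mat_adjoint V"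
    by (simp add: P mat_adjoint_mult mult_assoc_dim flip: V_def)
  hence K: "mat_adjoint P * (J * P) = \<i> \<cdot>\<^sub>m ?c K"
    using Vtilde_mat_J_mat[of n1 n2 na nb] T(2) by (simp add: V_def n3 K_def mult_assoc_dim)
  have Jm: "V_mat m * (J_mat m * mat_adjoint (V_mat m)) = \<i> \<cdot>\<^sub>m ?c (\<J> m)"
    using V_mat_J_mat[of m] by (simp add: mult_assoc_dim)
  \<comment> \<open>These rules remove the inserted pairs from right-nested products.\<close>
  note cancel = mult_cancel_inverse[OF PP] mult_cancel_inverse[OF V_mat_adjoint_mult]
  note real = map_mat_of_real_mult mat_adjoint_map_of_real[symmetric]

  have "\<i> \<cdot>\<^sub>m (?c Abar * ?c K) = mat_adjoint P * (A * J) * P"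
  proof -
    \<comment> \<open>The factor i is moved onto \<open>K\<close> because it is i times
      \<open>K\<close> that equals the conjugated \<open>J\<close>. The next two terms are treated
      alike.\<close>
    have "\<i> \<cdot>\<^sub>m (?c Abar * ?c K) = ?c Abar * (\<i> \<cdot>\<^sub>m ?c K)"
      by (simp add: smult_mult_dim)
    also have "\<dots> = mat_adjoint P * (A * J) * P"
      by (simp add: bar K[symmetric] mult_assoc_dim cancel)
    finally show ?thesis .
  qed
  moreover have "\<i> \<cdot>\<^sub>m (?c K * mat_adjoint (?c Abar)) = mat_adjoint P * (J * mat_adjoint A) * P"
  proof -
    have "\<i> \<cdot>\<^sub>m (?c K * mat_adjoint (?c Abar)) = (\<i> \<cdot>\<^sub>m ?c K) * mat_adjoint (?c Abar)"
      by (simp add: smult_mult_dim)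
    also have "\<dots> = mat_adjoint P * (J * mat_adjoint A) * P"
      by (simp add: bar K[symmetric] mat_adjoint_mult mult_assoc_dim cancel)
    finally show ?thesis .
  qed
  moreover have "\<i> \<cdot>\<^sub>m (?c Bbar * (?c (\<J> m) * mat_adjoint (?c Bbar))) =
    mat_adjoint P * (B * J_mat m * mat_adjoint B) * P"
  proof -
    have "\<i> \<cdot>\<^sub>m (?c Bbar * (?c (\<J> m) * mat_adjoint (?c Bbar))) =
        ?c Bbar * ((\<i> \<cdot>\<^sub>m ?c (\<J> m)) * mat_adjoint (?c Bbar))"
      by (simp add: smult_mult_dim)
    also have "\<dots> = mat_adjoint P * (B * J_mat m * mat_adjoint B) * P"
      by (simp add: bar Jm[symmetric] mat_adjoint_mult mult_assoc_dim cancel)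
    finally show ?thesis .
  qed
  ultimately have "\<i> \<cdot>\<^sub>m (?c Abar * ?c K) + \<i> \<cdot>\<^sub>m (?c K * mat_adjoint (?c Abar)) +
      \<i> \<cdot>\<^sub>m (?c Bbar * (?c (\<J> m) * mat_adjoint (?c Bbar))) =
    mat_adjoint P * (A * J + J * mat_adjoint A + B * J_mat m * mat_adjoint B) * P"
    by (simp add: mult_add_distrib_dim add_mult_distrib_dim)
  also have "\<dots> = 0\<^sub>m N N"
    unfolding sys(4) by simp
  finally have eq: "\<i> \<cdot>\<^sub>m ?c (Abar * K + K * Abar\<^sup>T + Bbar * \<J> m * Bbar\<^sup>T) = 0\<^sub>m N N"
    by (simp add: real mult_assoc_dim map_mat_of_real_add smult_add_dim)
  \<comment> \<open>The common factor i is nonzero and the embedding of the reals is injective, so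
    the equation descends to real matrices.\<close>
  have "X = 0\<^sub>m N N" if "\<i> \<cdot>\<^sub>m ?c X = 0\<^sub>m N N" for X
    using that by (auto simp: mat_eq_iff)
  from this[OF eq] show "Abar * K + K * Abar\<^sup>T + Bbar * \<J> m * Bbar\<^sup>T =
      0\<^sub>m (2 * (n1 + n2 + n3)) (2 * (n1 + n2 + n3))"
    unfolding N_def .

  have neg_smult: "- (- 1 \<cdot>\<^sub>m X) = X" for X :: "complex mat"
    by (intro eq_matI) auto
  \<comment> \<open>The two factors i multiply to -1, which absorbs the minus sign.\<close>
  have "?c Bbar = - ((\<i> \<cdot>\<^sub>m ?c K) * (mat_adjoint (?c Cbar) * (\<i> \<cdot>\<^sub>m ?c (\<J> m))))"
    unfolding bar(2,3) K[symmetric] Jm[symmetric] sys(5)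
    by (simp add: mat_adjoint_mult mult_assoc_dim cancel)
  also have "\<dots> = ?c (K * Cbar\<^sup>T * \<J> m)"
    by (simp add: smult_mult_dim real mult_assoc_dim smult_smult_mat neg_smult)
  finally show "Bbar = K * Cbar\<^sup>T * \<J> m"
    by (rule of_real_hom.mat_hom_inj)
qed

section \<open>Comparison of blocks in the Kalman coordinates\<close>

theorem lemma3p1:
  fixes n n1 n2 n3 m :: nat
    and A B C :: "complex mat"
    and Abar Bbar Cbar :: "real mat"
    and Ah11 Ah12 Ah22 A12 A13 A21 A31 Aco Acobar Bh Bco Ch Cco :: "real mat"
  assumes n: "n = n1 + n2 + n3"
    and system: "quantum_linear_system n m A B C"
    and kalman: "kalman_canonical_form n1 n2 n3 m A B C Abar Bbar Cbar"
    and dims_A: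
      "Ah11 \<in> carrier_mat n3 n3" "Ah12 \<in> carrier_mat n3 n3" "Ah22 \<in> carrier_mat n3 n3"
      "A12 \<in> carrier_mat n3 (2 * n1)" "A13 \<in> carrier_mat n3 (2 * n2)"
      "A21 \<in> carrier_mat (2 * n1) n3" "A31 \<in> carrier_mat (2 * n2) n3"
      "Aco \<in> carrier_mat (2 * n1) (2 * n1)" "Acobar \<in> carrier_mat (2 * n2) (2 * n2)"
    and dims_B: "Bh \<in> carrier_mat n3 (2 * m)" "Bco \<in> carrier_mat (2 * n1) (2 * m)"
    and dims_C: "Ch \<in> carrier_mat (2 * m) n3" "Cco \<in> carrier_mat (2 * m) (2 * n1)"
    and Abar:
      "Abar = (Ah11 @\<^sub>c Ah12 @\<^sub>c A12 @\<^sub>c A13)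
           @\<^sub>r (0\<^sub>m n3 n3 @\<^sub>c Ah22 @\<^sub>c 0\<^sub>m n3 (2 * n1) @\<^sub>c 0\<^sub>m n3 (2 * n2))
           @\<^sub>r (0\<^sub>m (2 * n1) n3 @\<^sub>c A21 @\<^sub>c Aco @\<^sub>c 0\<^sub>m (2 * n1) (2 * n2))
           @\<^sub>r (0\<^sub>m (2 * n2) n3 @\<^sub>c A31 @\<^sub>c 0\<^sub>m (2 * n2) (2 * n1) @\<^sub>c Acobar)"
    and Bbar: "Bbar = Bh @\<^sub>r 0\<^sub>m n3 (2 * m) @\<^sub>r Bco @\<^sub>r 0\<^sub>m (2 * n2) (2 * m)"
    and Cbar: "Cbar = 0\<^sub>m (2 * m) n3 @\<^sub>c Ch @\<^sub>c Cco @\<^sub>c 0\<^sub>m (2 * m) (2 * n2)"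
  shows "Ah22\<^sup>T = - Ah11 \<and>
         - Ah12 + Ah12\<^sup>T + Bh * \<J> m * Bh\<^sup>T = 0\<^sub>m n3 n3 \<and>
         - A12 + A21\<^sup>T * \<J> n1 + Bh * \<J> m * Bco\<^sup>T * \<J> n1 = 0\<^sub>m n3 (2 * n1) \<and>
         A31\<^sup>T * \<J> n2 = A13 \<and>
         \<J> n1 * Aco + Aco\<^sup>T * \<J> n1 - \<J> n1 * Bco * \<J> m * Bco\<^sup>T * \<J> n1 = 0\<^sub>m (2 * n1) (2 * n1) \<and>
         \<J> n2 * Acobar + Acobar\<^sup>T * \<J> n2 = 0\<^sub>m (2 * n2) (2 * n2) \<and>
         Bh = Ch\<^sup>T * \<J> m \<and>
         Bco = \<J> n1 * Cco\<^sup>T * \<J> m"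
proof -
  let ?K = "diag_block_mat [\<J> n3, \<J> n1, \<J> n2]"
  note dims [simp] = dims_A[THEN carrier_matD(1)] dims_A[THEN carrier_matD(2)]
    dims_B[THEN carrier_matD(1)] dims_B[THEN carrier_matD(2)]
    dims_C[THEN carrier_matD(1)] dims_C[THEN carrier_matD(2)]
  note real = kalman_canonical_form_realizable[OF system[unfolded n] kalman]
  \<comment> \<open>Four blocks face three diagonal blocks, so the first two are bracketed together
    for the product and separated again afterwards.\<close>
  have mult_K: "(X @\<^sub>c Y @\<^sub>c Z @\<^sub>c W) * ?K = - Y @\<^sub>c X @\<^sub>c Z * \<J> n1 @\<^sub>c W * \<J> n2"
    if "dim_col X = n3" "dim_col Y = n3" "dim_col Z = 2 * n1" "dim_col W = 2 * n2"
      "dim_row X = dim_row Y" "dim_row Y = dim_row Z" "dim_row Z = dim_row W"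
    for X Y Z W
    using that
    by (simp add: append_cols_assoc[symmetric, of X] append_cols_mult_diag_block_mat
        append_cols_mult_symp_mat dim_diag_block_mat del: diag_block_mat.simps)
      (simp add: append_cols_assoc)
  have K_mult: "?K * (X @\<^sub>r Y @\<^sub>r Z @\<^sub>r W) = Y @\<^sub>r - X @\<^sub>r \<J> n1 * Z @\<^sub>r \<J> n2 * W"
    if "dim_row X = n3" "dim_row Y = n3" "dim_row Z = 2 * n1" "dim_row W = 2 * n2"
      "dim_col X = dim_col Y" "dim_col Y = dim_col Z" "dim_col Z = dim_col W"
    for X Y Z W
    using that
    by (simp add: append_rows_assoc[symmetric, of X] diag_block_mat_mult_append_rows
        symp_mat_mult_append_rows dim_diag_block_mat del: diag_block_mat.simps)
      (simp add: append_rows_assoc)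

  \<comment> \<open>The swap of \<open>q_h\<close> and \<open>p_h\<close> moves \<open>Ch\<close>,
    which sits at \<open>p_h\<close> in \<open>Cbar\<close>, to the place of \<open>Bh\<close> at
    \<open>q_h\<close>.\<close>
  have "Bbar = Ch\<^sup>T * \<J> m @\<^sub>r 0\<^sub>m n3 (2 * m) @\<^sub>r \<J> n1 * Cco\<^sup>T * \<J> m @\<^sub>r 0\<^sub>m (2 * n2) (2 * m)"
    unfolding real(2) Cbar
    by (simp add: transpose_append_cols K_mult append_rows_mult uminus_zero_mat
      del: diag_block_mat.simps)
  hence B: "Bh = Ch\<^sup>T * \<J> m" "Bco = \<J> n1 * Cco\<^sup>T * \<J> m"
    unfolding Bbar by (simp_all add: append_rows_eq_iff)

  \<comment> \<open>The zero matrix is cut as a row of block columns, the shape in which the three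
    summands will be added.\<close>
  have zero: "0\<^sub>m (2 * (n1 + n2 + n3)) (2 * (n1 + n2 + n3)) =
     (0\<^sub>m n3 n3 @\<^sub>r 0\<^sub>m n3 n3 @\<^sub>r 0\<^sub>m (2 * n1) n3 @\<^sub>r 0\<^sub>m (2 * n2) n3) @\<^sub>c
     (0\<^sub>m n3 n3 @\<^sub>r 0\<^sub>m n3 n3 @\<^sub>r 0\<^sub>m (2 * n1) n3 @\<^sub>r 0\<^sub>m (2 * n2) n3) @\<^sub>c
     (0\<^sub>m n3 (2 * n1) @\<^sub>r 0\<^sub>m n3 (2 * n1) @\<^sub>r 0\<^sub>m (2 * n1) (2 * n1) @\<^sub>r 0\<^sub>m (2 * n2) (2 * n1)) @\<^sub>c
     (0\<^sub>m n3 (2 * n2) @\<^sub>r 0\<^sub>m n3 (2 * n2) @\<^sub>r 0\<^sub>m (2 * n1) (2 * n2) @\<^sub>r 0\<^sub>m (2 * n2) (2 * n2) :: real mat)"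
    unfolding zero_mat_append_cols[symmetric] zero_mat_append_rows[symmetric]
    by (rule arg_cong2[of _ _ _ _ "0\<^sub>m"]) simp_all
  have AK: "Abar * ?K =
     (- Ah12 @\<^sub>c Ah11 @\<^sub>c A12 * \<J> n1 @\<^sub>c A13 * \<J> n2) @\<^sub>r
     (- Ah22 @\<^sub>c 0\<^sub>m n3 n3 @\<^sub>c 0\<^sub>m n3 (2 * n1) @\<^sub>c 0\<^sub>m n3 (2 * n2)) @\<^sub>r
     (- A21 @\<^sub>c 0\<^sub>m (2 * n1) n3 @\<^sub>c Aco * \<J> n1 @\<^sub>c 0\<^sub>m (2 * n1) (2 * n2)) @\<^sub>r
     (- A31 @\<^sub>c 0\<^sub>m (2 * n2) n3 @\<^sub>c 0\<^sub>m (2 * n2) (2 * n1) @\<^sub>c Acobar * \<J> n2)"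
    unfolding Abar by (simp add: append_rows_mult mult_K dim_diag_block_mat del: diag_block_mat.simps)
  have KA: "?K * Abar\<^sup>T =
     (Ah12\<^sup>T @\<^sub>r - Ah11\<^sup>T @\<^sub>r \<J> n1 * A12\<^sup>T @\<^sub>r \<J> n2 * A13\<^sup>T) @\<^sub>c
     (Ah22\<^sup>T @\<^sub>r 0\<^sub>m n3 n3 @\<^sub>r 0\<^sub>m (2 * n1) n3 @\<^sub>r 0\<^sub>m (2 * n2) n3) @\<^sub>c
     (A21\<^sup>T @\<^sub>r 0\<^sub>m n3 (2 * n1) @\<^sub>r \<J> n1 * Aco\<^sup>T @\<^sub>r 0\<^sub>m (2 * n2) (2 * n1)) @\<^sub>c
     (A31\<^sup>T @\<^sub>r 0\<^sub>m n3 (2 * n2) @\<^sub>r 0\<^sub>m (2 * n1) (2 * n2) @\<^sub>r \<J> n2 * Acobar\<^sup>T)"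
    unfolding Abar by (simp add: transpose_append_rows transpose_append_cols mult_append_cols K_mult
      dim_diag_block_mat uminus_zero_mat del: diag_block_mat.simps)
  have BB: "Bbar * \<J> m * Bbar\<^sup>T =
     (Bh * \<J> m * Bh\<^sup>T @\<^sub>r 0\<^sub>m n3 n3 @\<^sub>r Bco * \<J> m * Bh\<^sup>T @\<^sub>r 0\<^sub>m (2 * n2) n3) @\<^sub>c
     (0\<^sub>m n3 n3 @\<^sub>r 0\<^sub>m n3 n3 @\<^sub>r 0\<^sub>m (2 * n1) n3 @\<^sub>r 0\<^sub>m (2 * n2) n3) @\<^sub>c
     (Bh * \<J> m * Bco\<^sup>T @\<^sub>r 0\<^sub>m n3 (2 * n1) @\<^sub>r Bco * \<J> m * Bco\<^sup>T @\<^sub>r 0\<^sub>m (2 * n2) (2 * n1)) @\<^sub>c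
     (0\<^sub>m n3 (2 * n2) @\<^sub>r 0\<^sub>m n3 (2 * n2) @\<^sub>r 0\<^sub>m (2 * n1) (2 * n2) @\<^sub>r 0\<^sub>m (2 * n2) (2 * n2))"
    unfolding Bbar
    by (simp add: transpose_append_rows mult_append_cols append_rows_mult append_rows_append_cols
      zero_mat_append_rows[symmetric])
  \<comment> \<open>The sum is skew-symmetric, so blocks below the diagonal repeat those above. On
    and above the diagonal, these six are the ones that do not read 0 = 0.\<close>
  have blocks: "- Ah12 + Ah12\<^sup>T + Bh * \<J> m * Bh\<^sup>T = 0\<^sub>m n3 n3"
    "Ah11 + Ah22\<^sup>T = 0\<^sub>m n3 n3"
    "A12 * \<J> n1 + A21\<^sup>T + Bh * \<J> m * Bco\<^sup>T = 0\<^sub>m n3 (2 * n1)"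
    "A13 * \<J> n2 + A31\<^sup>T = 0\<^sub>m n3 (2 * n2)"
    "Aco * \<J> n1 + \<J> n1 * Aco\<^sup>T + Bco * \<J> m * Bco\<^sup>T = 0\<^sub>m (2 * n1) (2 * n1)"
    "Acobar * \<J> n2 + \<J> n2 * Acobar\<^sup>T = 0\<^sub>m (2 * n2) (2 * n2)"
    using real(1) unfolding AK KA BB zero
    by (simp_all add: append_rows_append_cols add_append_cols add_append_rows append_cols_eq_iff
      append_rows_eq_iff add_zero_mat_dim)
  have JJ: "\<J> k * (\<J> k * X) = - X" if "dim_row X = 2 * k" for k and X :: "real mat"
    using that by (simp add: mult_assoc_dim[symmetric] symp_mat_square)
  have "Ah22\<^sup>T = - Ah11"
    using blocks(2) by (rule add_eq_zero_mat_imp) simp_all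
  \<comment> \<open>Right multiplication by \<open>\<J> n1\<close>, whose square is -1, frees
    \<open>A12\<close> with a minus sign. \<open>A13\<close> is freed in the same way.\<close>
  moreover have "- A12 + A21\<^sup>T * \<J> n1 + Bh * \<J> m * Bco\<^sup>T * \<J> n1 = 0\<^sub>m n3 (2 * n1)"
    using arg_cong[OF blocks(3), of "\<lambda>X. X * \<J> n1"]
    by (simp add: add_mult_distrib_dim mult_assoc_dim symp_mat_square)
  moreover have "A31\<^sup>T * \<J> n2 = A13"
  proof -
    have "- A13 + A31\<^sup>T * \<J> n2 = 0\<^sub>m n3 (2 * n2)"
      using arg_cong[OF blocks(4), of "\<lambda>X. X * \<J> n2"]
      by (simp add: add_mult_distrib_dim mult_assoc_dim symp_mat_square)
    hence "A31\<^sup>T * \<J> n2 = - (- A13)"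
      by (rule add_eq_zero_mat_imp) simp_all
    thus ?thesis by simp
  qed
  moreover have "\<J> n1 * Aco + Aco\<^sup>T * \<J> n1 - \<J> n1 * Bco * \<J> m * Bco\<^sup>T * \<J> n1 = 0\<^sub>m (2 * n1) (2 * n1)"
  proof -
    \<comment> \<open>Multiplying by \<open>\<J> n1\<close> on both sides moves the symplectic
      factor to the other side of \<open>Aco\<close> and its transpose, each time with a minus sign.
      A final negation gives the stated signs.\<close>
    have "- (\<J> n1 * Aco) + - (Aco\<^sup>T * \<J> n1) + \<J> n1 * Bco * \<J> m * Bco\<^sup>T * \<J> n1 = 0\<^sub>m (2 * n1) (2 * n1)"
      using arg_cong[OF blocks(5), of "\<lambda>X. \<J> n1 * X * \<J> n1"]
      by (simp add: add_mult_distrib_dim mult_add_distrib_dim mult_assoc_dim symp_mat_square JJ)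
    from arg_cong[OF this, of uminus] show ?thesis
      unfolding uminus_zero_mat
      by (rule trans[rotated]) (intro eq_matI, simp_all)
  qed
  moreover have "\<J> n2 * Acobar + Acobar\<^sup>T * \<J> n2 = 0\<^sub>m (2 * n2) (2 * n2)"
  proof -
    have "- (\<J> n2 * Acobar) + - (Acobar\<^sup>T * \<J> n2) = 0\<^sub>m (2 * n2) (2 * n2)"
      using arg_cong[OF blocks(6), of "\<lambda>X. \<J> n2 * X * \<J> n2"]
      by (simp add: add_mult_distrib_dim mult_add_distrib_dim mult_assoc_dim symp_mat_square JJ)
    from arg_cong[OF this, of uminus] show ?thesis
      unfolding uminus_zero_mat
      by (rule trans[rotated]) (intro eq_matI, simp_all)
  qed
  ultimately show ?thesis
    using blocks(1) B by (intro conjI)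
qed

end
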